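(* Let $\|\cdot\|$ be a matrix norm on $\mathbb{R}^{3\times3}$. Suppose an algorithm for evaluating the discriminant $\Delta$ is backward stable in the relative deviatoric sense, i.e. there is a constant $C_0$ such that for every $\mathbf A\in\mathbb{R}^{3\times3}$ its computed value $\mathrm{fl}(\Delta(\mathbf A))$ satisfies $\mathrm{fl}(\Delta(\mathbf A))=\Delta(\mathbf A+\delta\mathbf A)$ for some $\delta\mathbf A\in\mathbb{R}^{3\times3}$ with $\|\mathrm{dev}(\delta\mathbf A)\|\le C_0\,\epsilon\,\|\mathrm{dev}(\mathbf A)\|$. Then the algorithm is forward stable in the sense that there is a constant $C$, depending only on $C_0$ and the norm, such that for every $\mathbf A\in\mathbb{R}^{3\times 3}$ $$|\mathrm{fl}(\Delta(\mathbf A))-\Delta(\mathbf A)|\le C\,\big\|\mathrm{dev}\big(12J_2^2\,\mathbf A^{\mathsf T}-54J_3\,\mathrm{cof}(\mathrm{dev}(\mathbf A))\big)\big\|\,\|\mathrm{dev}(\mathbf A)\|\,\epsilon+\mathcal O(\epsilon^2),$$ where $J_2=J_2(\mathbf A)$ and $J_3=J_3(\mathbf A)$.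
   Context: For $\mathbf A\in\mathbb{R}^{3\times3}$, $\mathrm{dev}(\mathbf A)=\mathbf A-\tfrac13\mathrm{tr}(\mathbf A)\mathbf I$, $J_2(\mathbf A)=\tfrac12\mathrm{tr}(\mathrm{dev}(\mathbf A)^2)$, $J_3(\mathbf A)=\det(\mathrm{dev}(\mathbf A))$, $\Delta(\mathbf A)=4J_2(\mathbf A)^3-27J_3(\mathbf A)^2$, and $\mathrm{cof}(\mathbf A)$ is the cofactor matrix (the transpose of the adjugate). $\epsilon>0$ is the unit roundoff of the floating-point arithmetic; $\mathrm{fl}(\Delta(\mathbf A))$ denotes the output of the algorithm run in that arithmetic. $\mathcal O(\epsilon^2)$ is understood as $\epsilon\to0$ for fixed $\mathbf A$: a quantity bounded by $K\epsilon^2$ for all sufficiently small $\epsilon$, with $K$ independent of $\epsilon$ (but possibly depending on $\mathbf A$, $C_0$ and the norm). *)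

theory Defs
  imports "HOL-Analysis.Analysis"
begin

type_synonym mat3 = "real ^ 3 ^ 3"

text \<open>An arbitrary vector-space norm on the real 3-by-3 matrices. Submultiplicativity is not
  required, so submultiplicative norms are covered as a special case. Nonnegativity follows from
  the three axioms.\<close>

definition matrix_norm :: "(mat3 \<Rightarrow> real) \<Rightarrow> bool" where
  "matrix_norm N \<longleftrightarrow>
     (\<forall>A. N A = 0 \<longleftrightarrow> A = 0) \<and>
     (\<forall>c A. N (c *\<^sub>R A) = \<bar>c\<bar> * N A) \<and>
     (\<forall>A B. N (A + B) \<le> N A + N B)"

definition dev :: "mat3 \<Rightarrow> mat3" where
  "dev A = A - (trace A / 3) *\<^sub>R mat 1"

definition J2 :: "mat3 \<Rightarrow> real" where
  "J2 A = trace (dev A ** dev A) / 2"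

definition J3 :: "mat3 \<Rightarrow> real" where
  "J3 A = det (dev A)"

definition disc :: "mat3 \<Rightarrow> real" where
  "disc A = 4 * J2 A ^ 3 - 27 * J3 A ^ 2"

text \<open>The signed (i,j) minor is the determinant of the matrix in which row i and column j are
  replaced by zeros, except for a one at position (i,j).\<close>

definition cof :: "mat3 \<Rightarrow> mat3" where
  "cof A = (\<chi> i j. det ((\<chi> k l. if k = i \<and> l = j then 1
                               else if k = i \<or> l = j then 0
                               else A $ k $ l) :: mat3))"

lemma cof_explicit:
  "cof A = vector
     [vector [A$2$2 * A$3$3 - A$2$3 * A$3$2, - (A$2$1 * A$3$3 - A$2$3 * A$3$1), A$2$1 * A$3$2 - A$2$2 * A$3$1],
      vector [- (A$1$2 * A$3$3 - A$1$3 * A$3$2), A$1$1 * A$3$3 - A$1$3 * A$3$1, - (A$1$1 * A$3$2 - A$1$2 * A$3$1)],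
      vector [A$1$2 * A$2$3 - A$1$3 * A$2$2, - (A$1$1 * A$2$3 - A$1$3 * A$2$1), A$1$1 * A$2$2 - A$1$2 * A$2$1]]"
  by (simp add: cof_def vec_eq_iff forall_3 det_3)

lemma matrix_mult_transpose_cof: "A ** transpose (cof A) = det A *\<^sub>R mat 1"
  by (simp add: cof_explicit vec_eq_iff forall_3 det_3 matrix_matrix_mult_def transpose_def
      mat_def sum_3 algebra_simps)

text \<open>An algorithm is modelled by the family of its outputs: \<open>fl \<epsilon> A\<close> is the value computed for the
  discriminant of \<open>A\<close> in the arithmetic of unit roundoff \<open>\<epsilon>\<close>, and \<open>E\<close> is the set of unit roundoffs
  of the arithmetics considered. The constant \<open>C0\<close> is common to all of them.\<close>

definition backward_stable_dev ::
    "(mat3 \<Rightarrow> real) \<Rightarrow> real \<Rightarrow> real set \<Rightarrow> (real \<Rightarrow> mat3 \<Rightarrow> real) \<Rightarrow> bool" where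
  "backward_stable_dev N C0 E fl \<longleftrightarrow>
     (\<forall>\<epsilon>\<in>E. \<forall>A. \<exists>\<delta>A. fl \<epsilon> A = disc (A + \<delta>A) \<and> N (dev \<delta>A) \<le> C0 * \<epsilon> * N (dev A))"

end

theory Submission
  imports Defs
begin

text \<open>The discriminant depends on \<open>A\<close> only through \<open>D = dev A\<close>. Expanding \<open>4 J2^3 - 27 J3^2\<close> at
  \<open>D + H\<close> with \<open>H\<close> trace-free, the linear term is the Frobenius inner product of \<open>H\<close> with
  \<open>12 J2^2 A\<^sup>T - 54 J3 cof D\<close>, whose spherical part is orthogonal to \<open>H\<close> and may be dropped.
  Cauchy-Schwarz and the equivalence of \<open>N\<close> with the Frobenius norm bound this term; the
  remainder is quadratic in \<open>H\<close>.\<close>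

text \<open>One half of the equivalence of norms. The triangle inequality and homogeneity make
  \<open>N\<close> convex, hence continuous in finite dimension, so \<open>N\<close> attains a
  minimum on the unit sphere. This minimum is positive by definiteness, and \<open>m\<close> is its
  reciprocal.\<close>

lemma norm_le_mult_of_norm_axioms:
  fixes N :: "'a::euclidean_space \<Rightarrow> real"
  assumes zero: "\<And>x. N x = 0 \<longleftrightarrow> x = 0"
    and scale: "\<And>c x. N (c *\<^sub>R x) = \<bar>c\<bar> * N x"
    and triangle: "\<And>x y. N (x + y) \<le> N x + N y"
  obtains m where "m > 0" "\<And>x. norm x \<le> m * N x"
proof -
  have nonneg: "0 \<le> N x" for x
    using triangle[of x "(-1) *\<^sub>R x"] scale[of "-1" x] zero[of 0] by simp
  have "convex_on UNIV N"
  proof (rule convex_onI)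
    fix t :: real and x y assume "0 < t" "t < 1"
    then show "N ((1 - t) *\<^sub>R x + t *\<^sub>R y) \<le> (1 - t) * N x + t * N y"
      using triangle[of "(1 - t) *\<^sub>R x" "t *\<^sub>R y"] by (simp add: scale)
  qed simp
  then have "continuous_on UNIV N"
    by (rule convex_on_continuous[OF open_UNIV])
  then have "continuous_on (sphere 0 1) N"
    by (rule continuous_on_subset) simp
  then obtain z where z: "z \<in> sphere 0 1" "\<And>x. x \<in> sphere 0 1 \<Longrightarrow> N z \<le> N x"
    using continuous_attains_inf[of "sphere (0::'a) 1" N] by auto
  have "N z > 0"
    using z(1) zero[of z] nonneg[of z] by auto
  have "norm x \<le> inverse (N z) * N x" for x
  proof (cases "x = 0")
    case False
    then have "N z \<le> N (inverse (norm x) *\<^sub>R x)"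
      by (intro z) simp
    then show ?thesis
      using False \<open>N z > 0\<close> by (simp add: scale field_simps)
  qed (simp add: zero nonneg)
  then show thesis
    using that[of "inverse (N z)"] \<open>N z > 0\<close> by simp
qed

text \<open>Compactness bounds \<open>f\<close> on the unit ball, and homogeneity carries the bound
  to every \<open>x\<close>. It serves for the quadratic and cubic forms in the
  perturbation.\<close>

lemma homogeneous_bound:
  fixes f :: "'a::euclidean_space \<Rightarrow> real"
  assumes cont: "continuous_on UNIV f"
    and scale: "\<And>c x. f (c *\<^sub>R x) = c ^ k * f x"
  obtains B where "B \<ge> 0" "\<And>x. \<bar>f x\<bar> \<le> B * norm x ^ k"
proof -
  \<comment> \<open>The ball is used instead of the sphere because it contains \<open>sgn x\<close>
    even for \<open>x = 0\<close>, where \<open>sgn x = 0\<close>.\<close>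
  have "compact (f ` cball 0 1)"
    by (intro compact_continuous_image continuous_on_subset[OF cont]) auto
  then obtain B where B: "\<And>x. x \<in> cball 0 1 \<Longrightarrow> \<bar>f x\<bar> \<le> B"
    using bounded_iff[of "f ` cball 0 1"] compact_imp_bounded by fastforce
  have "B \<ge> 0"
    using B[of 0] by simp
  moreover have "\<bar>f x\<bar> \<le> B * norm x ^ k" for x
  proof -
    have "norm x *\<^sub>R sgn x = x"
      by (cases "x = 0") (simp_all add: sgn_div_norm)
    then have "\<bar>f x\<bar> = norm x ^ k * \<bar>f (sgn x)\<bar>"
      using scale[of "norm x" "sgn x"] by (simp add: abs_mult)
    also have "\<dots> \<le> norm x ^ k * B"
      by (intro mult_left_mono B) (auto simp: norm_sgn)
    finally show ?thesis by (simp add: mult.commute)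
  qed
  ultimately show thesis by (rule that)
qed

lemma inner_mat3:
  fixes A B :: mat3
  shows "A \<bullet> B = A$1$1 * B$1$1 + A$1$2 * B$1$2 + A$1$3 * B$1$3
    + A$2$1 * B$2$1 + A$2$2 * B$2$2 + A$2$3 * B$2$3
    + A$3$1 * B$3$1 + A$3$2 * B$3$2 + A$3$3 * B$3$3"
  by (simp add: inner_vec_def sum_3)

lemma dev_add: "dev (A + B) = dev A + dev B"
  by (simp add: dev_def trace_add add_divide_distrib scaleR_add_left)

lemma trace_dev [simp]: "trace (dev A) = 0"
  by (simp add: dev_def trace_def sum_3 mat_def field_simps)

text \<open>The identity matrix is Frobenius-orthogonal to every trace-free matrix, because its
  inner product with \<open>H\<close> is the trace of \<open>H\<close>.\<close>

lemma inner_dev_left: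
  assumes "trace H = 0"
  shows "dev G \<bullet> H = G \<bullet> H"
proof -
  have "mat 1 \<bullet> H = trace H"
    by (simp add: inner_mat3 trace_def sum_3 mat_def)
  with assms show ?thesis
    by (simp add: dev_def inner_diff_left)
qed

text \<open>The differential of \<open>J2\<close> at \<open>A\<close> in a trace-free direction.
  Since \<open>dev\<close> commutes with transposition, the spherical part of \<open>A\<close> drops
  out, so \<open>transpose A\<close> may appear without \<open>dev\<close>.\<close>

lemma trace_dev_mult:
  assumes "trace H = 0"
  shows "trace (dev A ** H) = transpose A \<bullet> H"
proof -
  have "trace (B ** H) = transpose B \<bullet> H" for B :: mat3
    by (simp add: inner_mat3 trace_def sum_3 matrix_matrix_mult_def transpose_def)
  moreover have "transpose (dev A) = dev (transpose A)"
    by (simp add: dev_def vec_eq_iff transpose_def mat_def trace_def)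
  ultimately show ?thesis
    by (simp add: inner_dev_left assms)
qed

lemma trace_square_add:
  fixes D H :: mat3
  shows "trace ((D + H) ** (D + H)) = trace (D ** D) + 2 * trace (D ** H) + trace (H ** H)"
  by (simp add: trace_def sum_3 matrix_matrix_mult_def algebra_simps)

text \<open>The expansion of \<open>det\<close> sorted by degree in \<open>H\<close>. The linear
  term is Jacobi's formula, with the cofactor matrix as gradient; the quadratic term mirrors it with
  \<open>D\<close> and \<open>H\<close> exchanged.\<close>

lemma det_add_mat3:
  fixes D H :: mat3
  shows "det (D + H) = det D + cof D \<bullet> H + D \<bullet> cof H + det H"
  by (simp add: det_3 inner_mat3 cof_explicit algebra_simps)

text \<open>The scalar core of the expansion: \<open>a\<close> and \<open>d\<close> stand for
  \<open>J2\<close> and \<open>J3\<close>, \<open>u'\<close> and \<open>v'\<close> for their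
  increments, \<open>u\<close> and \<open>v\<close> for the linear parts of these, \<open>c\<close>
  and \<open>f\<close> for the rest, and \<open>h\<close> for the size of the perturbation.\<close>

lemma remainder_bound:
  fixes a u u' c d v v' f :: real
  assumes "0 \<le> h" "h \<le> 1" "\<bar>u'\<bar> \<le> U * h" "\<bar>c\<bar> \<le> U2 * h\<^sup>2" "\<bar>v'\<bar> \<le> V * h" "\<bar>f\<bar> \<le> V2 * h\<^sup>2"
    and "0 \<le> U" "0 \<le> V"
    and u: "u' = u + c" and v: "v' = v + f"
  shows "\<bar>(4 * (a + u') ^ 3 - 27 * (d + v')\<^sup>2) - (4 * a ^ 3 - 27 * d\<^sup>2)
           - (12 * a\<^sup>2 * u - 54 * d * v)\<bar>
         \<le> (12 * \<bar>a\<bar> * U\<^sup>2 + 4 * U ^ 3 + 12 * a\<^sup>2 * U2 + 27 * V\<^sup>2 + 54 * \<bar>d\<bar> * V2) * h\<^sup>2"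
proof -
  have uu: "u'\<^sup>2 \<le> U\<^sup>2 * h\<^sup>2" and vv: "v'\<^sup>2 \<le> V\<^sup>2 * h\<^sup>2"
    using assms power_mono[of "\<bar>u'\<bar>" "U * h" 2] power_mono[of "\<bar>v'\<bar>" "V * h" 2]
    by (simp_all add: power_mult_distrib)
  have "\<bar>u'\<bar> ^ 3 \<le> (U * h) ^ 3"
    using assms by (intro power_mono) auto
  also have "\<dots> = U ^ 3 * h\<^sup>2 * h"
    by (simp add: power_mult_distrib power3_eq_cube power2_eq_square)
  \<comment> \<open>Here \<open>h \<le> 1\<close> lowers the cubic order to a quadratic one.\<close>
  also have "\<dots> \<le> U ^ 3 * h\<^sup>2"
    using assms by (simp add: mult_left_le)
  finally have uuu: "\<bar>u' ^ 3\<bar> \<le> U ^ 3 * h\<^sup>2"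
    by (simp add: power_abs)
  have b1: "\<bar>a * u'\<^sup>2\<bar> \<le> \<bar>a\<bar> * (U\<^sup>2 * h\<^sup>2)"
    unfolding abs_mult using uu by (intro mult_left_mono) auto
  have b2: "\<bar>a\<^sup>2 * c\<bar> \<le> a\<^sup>2 * (U2 * h\<^sup>2)"
    unfolding abs_mult using assms by (simp add: mult_left_mono)
  have b3: "\<bar>d * f\<bar> \<le> \<bar>d\<bar> * (V2 * h\<^sup>2)"
    unfolding abs_mult using assms by (intro mult_left_mono) auto
  \<comment> \<open>Splitting \<open>u'\<close> and \<open>v'\<close> only where they occur to first
    order cancels the linear part. Every surviving term is of order
    \<open>h\<^sup>2\<close>.\<close>
  have "(4 * (a + u') ^ 3 - 27 * (d + v')\<^sup>2) - (4 * a ^ 3 - 27 * d\<^sup>2) - (12 * a\<^sup>2 * u - 54 * d * v)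
      = 12 * (a * u'\<^sup>2) + 4 * u' ^ 3 + 12 * (a\<^sup>2 * c) - 27 * v'\<^sup>2 - 54 * (d * f)" (is "?lhs = ?rhs")
    by (simp add: u v power2_eq_square power3_eq_cube algebra_simps)
  moreover have "\<bar>?rhs\<bar> \<le> 12 * (\<bar>a\<bar> * (U\<^sup>2 * h\<^sup>2)) + 4 * (U ^ 3 * h\<^sup>2) + 12 * (a\<^sup>2 * (U2 * h\<^sup>2))
      + 27 * (V\<^sup>2 * h\<^sup>2) + 54 * (\<bar>d\<bar> * (V2 * h\<^sup>2))" (is "_ \<le> ?bound")
    using b1 b2 b3 uuu vv zero_le_power2[of v'] by linarith
  ultimately have "\<bar>?lhs\<bar> \<le> ?bound"
    by (simp only:)
  then show ?thesis
    by (simp only: distrib_right mult.assoc)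
qed

text \<open>For \<open>h \<le> 1\<close> a second-order term is absorbed into a first-order bound.
  This bounds the full increments of \<open>J2\<close> and \<open>J3\<close>.\<close>

lemma abs_add_le_linear:
  fixes x y h :: real
  assumes "\<bar>x\<bar> \<le> X * h" "\<bar>y\<bar> \<le> Y * h\<^sup>2" "0 \<le> h" "h \<le> 1" "0 \<le> Y"
  shows "\<bar>x + y\<bar> \<le> (X + Y) * h"
proof -
  have "Y * h\<^sup>2 \<le> Y * h"
    using assms by (intro mult_left_mono) (auto simp: power2_eq_square mult_left_le)
  with assms show ?thesis
    by (simp add: distrib_right)
qed

lemma disc_expansion:
  obtains K where "K \<ge> 0"
    "\<And>X. norm (dev X) \<le> 1 \<Longrightarrow>
       \<bar>disc (A + X) - disc A
         - dev ((12 * (J2 A)\<^sup>2) *\<^sub>R transpose A - (54 * J3 A) *\<^sub>R cof (dev A)) \<bullet> dev X\<bar>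
       \<le> K * (norm (dev X))\<^sup>2"
proof -
  let ?D = "dev A"
  \<comment> \<open>\<open>T\<close>, \<open>P\<close> and \<open>Q\<close> control the nonlinear
    parts of the increments: the quadratic part for \<open>J2\<close>, then the quadratic and cubic
    parts for \<open>J3\<close>.\<close>
  obtain T where T: "T \<ge> 0" "\<And>H::mat3. \<bar>trace (H ** H) / 2\<bar> \<le> T * norm H ^ 2"
  proof (rule homogeneous_bound[of "\<lambda>H::mat3. trace (H ** H) / 2" 2])
    show "continuous_on UNIV (\<lambda>H::mat3. trace (H ** H) / 2)"
      by (simp add: trace_def sum_3 matrix_matrix_mult_def) (intro continuous_intros, simp)
    show "trace ((c *\<^sub>R H) ** (c *\<^sub>R H)) / 2 = c\<^sup>2 * (trace (H ** H) / 2)" for c and H :: mat3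
      by (simp add: trace_def sum_3 matrix_matrix_mult_def power2_eq_square algebra_simps)
  qed blast
  obtain P where P: "P \<ge> 0" "\<And>H::mat3. \<bar>?D \<bullet> cof H\<bar> \<le> P * norm H ^ 2"
  proof (rule homogeneous_bound[of "\<lambda>H::mat3. ?D \<bullet> cof H" 2])
    show "continuous_on UNIV (\<lambda>H. ?D \<bullet> cof H)"
      by (simp add: inner_mat3 cof_explicit) (intro continuous_intros)
    show "?D \<bullet> cof (c *\<^sub>R H) = c\<^sup>2 * (?D \<bullet> cof H)" for c and H :: mat3
      by (simp add: inner_mat3 cof_explicit power2_eq_square algebra_simps)
  qed blast
  obtain Q where Q: "Q \<ge> 0" "\<And>H::mat3. \<bar>det H\<bar> \<le> Q * norm H ^ 3"
  proof (rule homogeneous_bound[of "det :: mat3 \<Rightarrow> real" 3])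
    show "continuous_on UNIV (det :: mat3 \<Rightarrow> real)"
      by (simp add: det_3) (intro continuous_intros)
    show "det (c *\<^sub>R H) = c ^ 3 * det H" for c and H :: mat3
      by (simp add: det_3 power3_eq_cube algebra_simps)
  qed blast
  \<comment> \<open>\<open>U\<close> and \<open>V\<close> bound the increments of \<open>J2\<close>
    and \<open>J3\<close> relative to \<open>norm (dev X)\<close> in the unit ball: the norm of the
    gradient plus the constant of the nonlinear part. \<open>K\<close> is then the coefficient from
    \<open>remainder_bound\<close>.\<close>
  define U where "U = norm (transpose A) + T"
  define V where "V = norm (cof ?D) + (P + Q)"
  define K where "K = 12 * \<bar>J2 A\<bar> * U\<^sup>2 + 4 * U ^ 3 + 12 * (J2 A)\<^sup>2 * T + 27 * V\<^sup>2
    + 54 * \<bar>J3 A\<bar> * (P + Q)"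
  have "U \<ge> 0" "V \<ge> 0"
    using T(1) P(1) Q(1) by (simp_all add: U_def V_def)
  moreover from this have "K \<ge> 0"
    using T(1) P(1) Q(1) by (simp add: K_def)
  moreover have "\<bar>disc (A + X) - disc A
         - dev ((12 * (J2 A)\<^sup>2) *\<^sub>R transpose A - (54 * J3 A) *\<^sub>R cof ?D) \<bullet> dev X\<bar>
       \<le> K * (norm (dev X))\<^sup>2"
    if h: "norm (dev X) \<le> 1" for X
  proof -
    let ?H = "dev X"
    define c where "c = trace (?H ** ?H) / 2"
    define f where "f = ?D \<bullet> cof ?H + det ?H"
    have J2X: "J2 (A + X) = J2 A + (transpose A \<bullet> ?H + c)"
      by (simp add: J2_def dev_add trace_square_add trace_dev_mult c_def)
    have J3X: "J3 (A + X) = J3 A + (cof ?D \<bullet> ?H + f)"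
      by (simp add: J3_def dev_add det_add_mat3 f_def)
    have c: "\<bar>c\<bar> \<le> T * (norm ?H)\<^sup>2"
      unfolding c_def by (rule T)
    have "Q * norm ?H ^ 3 \<le> Q * (norm ?H)\<^sup>2"
      using Q(1) h by (intro mult_left_mono power_decreasing) auto
    then have f: "\<bar>f\<bar> \<le> (P + Q) * (norm ?H)\<^sup>2"
      using P(2)[of ?H] Q(2)[of ?H] by (simp add: f_def distrib_right)
    have u': "\<bar>transpose A \<bullet> ?H + c\<bar> \<le> U * norm ?H"
      unfolding U_def
      by (intro abs_add_le_linear Cauchy_Schwarz_ineq2 c h norm_ge_zero T(1))
    have v': "\<bar>cof ?D \<bullet> ?H + f\<bar> \<le> V * norm ?H"
      unfolding V_def
      by (intro abs_add_le_linear Cauchy_Schwarz_ineq2 f h norm_ge_zero add_nonneg_nonneg P(1) Q(1))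
    have G: "dev ((12 * (J2 A)\<^sup>2) *\<^sub>R transpose A - (54 * J3 A) *\<^sub>R cof ?D) \<bullet> ?H
        = 12 * (J2 A)\<^sup>2 * (transpose A \<bullet> ?H) - 54 * J3 A * (cof ?D \<bullet> ?H)"
      by (simp add: inner_dev_left inner_diff_left)
    show ?thesis
      unfolding disc_def J2X J3X G K_def
      by (rule remainder_bound[OF norm_ge_zero h u' c v' f \<open>U \<ge> 0\<close> \<open>V \<ge> 0\<close> refl refl])
  qed
  ultimately show thesis
    using that by blast
qed

text \<open>The quantifier order expresses the dependence of the constants: \<open>C\<close> is
  fixed before \<open>A\<close>, while \<open>K\<close> and \<open>\<epsilon>0\<close> may depend on
  \<open>A\<close> but are uniform over all \<open>E\<close> and \<open>fl\<close>.\<close>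

theorem lemma10:
  fixes N :: "mat3 \<Rightarrow> real" and C0 :: real
  assumes "matrix_norm N"
  shows "\<exists>C. \<forall>A. \<exists>K. \<exists>\<epsilon>0>0. \<forall>(E :: real set) (fl :: real \<Rightarrow> mat3 \<Rightarrow> real).
           E \<subseteq> {0<..} \<longrightarrow> backward_stable_dev N C0 E fl \<longrightarrow>
           (\<forall>\<epsilon>\<in>E. \<epsilon> < \<epsilon>0 \<longrightarrow>
              \<bar>fl \<epsilon> A - disc A\<bar>
                \<le> C * N (dev ((12 * (J2 A)\<^sup>2) *\<^sub>R transpose A - (54 * J3 A) *\<^sub>R cof (dev A)))
                    * N (dev A) * \<epsilon> + K * \<epsilon>\<^sup>2)"
proof -
  obtain m where m: "m > 0" "\<And>x. norm x \<le> m * N x"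
    using norm_le_mult_of_norm_axioms[of N] assms unfolding matrix_norm_def by metis
  have N_nonneg: "0 \<le> N x" for x
    using m norm_ge_zero[of x] by (metis order_trans zero_le_mult_iff not_le)
  show ?thesis
  \<comment> \<open>One factor \<open>m\<close> converts the norm of the gradient to
    \<open>N\<close>, the other that of the perturbation. The absolute value covers a
    \<open>C0\<close> of either sign.\<close>
  proof (rule exI[of _ "m\<^sup>2 * \<bar>C0\<bar>"], rule allI)
    fix A
    let ?G = "dev ((12 * (J2 A)\<^sup>2) *\<^sub>R transpose A - (54 * J3 A) *\<^sub>R cof (dev A))"
    obtain K where K: "K \<ge> 0" "\<And>X. norm (dev X) \<le> 1 \<Longrightarrow>
        \<bar>disc (A + X) - disc A - ?G \<bullet> dev X\<bar> \<le> K * (norm (dev X))\<^sup>2"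
      using disc_expansion[of A] by blast
    define M where "M = m * \<bar>C0\<bar> * N (dev A)"
    have "M \<ge> 0"
      using m(1) N_nonneg by (simp add: M_def)
    have main: "\<bar>fl \<epsilon> A - disc A\<bar> \<le> m\<^sup>2 * \<bar>C0\<bar> * N ?G * N (dev A) * \<epsilon> + K * M\<^sup>2 * \<epsilon>\<^sup>2"
      if E: "E \<subseteq> {0<..}" "backward_stable_dev N C0 E fl" "\<epsilon> \<in> E" and small: "\<epsilon> < 1 / (M + 1)"
      for E fl \<epsilon>
    proof -
      have "\<epsilon> > 0"
        using E by auto
      obtain X where fl: "fl \<epsilon> A = disc (A + X)" and "N (dev X) \<le> C0 * \<epsilon> * N (dev A)"
        using E unfolding backward_stable_dev_def by blast
      moreover have "C0 * \<epsilon> * N (dev A) \<le> \<bar>C0\<bar> * \<epsilon> * N (dev A)"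
        using \<open>\<epsilon> > 0\<close> N_nonneg by (intro mult_right_mono) auto
      ultimately have "m * N (dev X) \<le> m * (\<bar>C0\<bar> * \<epsilon> * N (dev A))"
        using m(1) by (intro mult_left_mono) auto
      then have X: "norm (dev X) \<le> M * \<epsilon>"
        using m(2)[of "dev X"] by (simp add: M_def algebra_simps)
      \<comment> \<open>The threshold \<open>1 / (M + 1)\<close> forces
        \<open>M * \<epsilon> \<le> 1\<close>, which puts \<open>dev X\<close> in the unit ball
        where the expansion holds; the added 1 avoids division by zero when
        \<open>M = 0\<close>.\<close>
      have "(M + 1) * \<epsilon> \<le> 1"
        using small \<open>M \<ge> 0\<close> by (simp add: field_simps)
      then have "norm (dev X) \<le> 1"
        using X \<open>\<epsilon> > 0\<close> by (simp add: distrib_right)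
      then have "\<bar>disc (A + X) - disc A - ?G \<bullet> dev X\<bar> \<le> K * (norm (dev X))\<^sup>2"
        by (rule K)
      also have "\<dots> \<le> K * (M * \<epsilon>)\<^sup>2"
        using X K(1) by (intro mult_left_mono power_mono) auto
      finally have remainder: "\<bar>disc (A + X) - disc A - ?G \<bullet> dev X\<bar> \<le> K * M\<^sup>2 * \<epsilon>\<^sup>2"
        by (simp add: power_mult_distrib)
      \<comment> \<open>The first-order term: Cauchy-Schwarz in the Frobenius norm, followed by a
        comparison with \<open>N\<close>.\<close>
      have "\<bar>?G \<bullet> dev X\<bar> \<le> norm ?G * norm (dev X)"
        by (rule Cauchy_Schwarz_ineq2)
      also have "\<dots> \<le> (m * N ?G) * (M * \<epsilon>)"
        using m N_nonneg X by (intro mult_mono) auto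
      also have "\<dots> = m\<^sup>2 * \<bar>C0\<bar> * N ?G * N (dev A) * \<epsilon>"
        by (simp add: M_def power2_eq_square)
      finally show ?thesis
        using remainder unfolding fl by linarith
    qed
    show "\<exists>K. \<exists>\<epsilon>0>0. \<forall>(E :: real set) (fl :: real \<Rightarrow> mat3 \<Rightarrow> real).
           E \<subseteq> {0<..} \<longrightarrow> backward_stable_dev N C0 E fl \<longrightarrow>
           (\<forall>\<epsilon>\<in>E. \<epsilon> < \<epsilon>0 \<longrightarrow>
              \<bar>fl \<epsilon> A - disc A\<bar> \<le> m\<^sup>2 * \<bar>C0\<bar> * N ?G * N (dev A) * \<epsilon> + K * \<epsilon>\<^sup>2)"
      using main \<open>M \<ge> 0\<close>
      by (intro exI[of _ "K * M\<^sup>2"] exI[of _ "1 / (M + 1)"]) auto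
  qed
qed

end
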